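(* Let $k \ge 0$ and $m \ge 1$ be integers, and let $\mathfrak{G}(2^{k+1}-1,m,0) = [2^{k+1}-1,\; 2^{k+1} m,\; 2^{k+1}(m+1)-1]$. Then $$V(\mathfrak{G}(2^{k+1} - 1, m, 0)) \le (2^{k+2} - 2)m + (2^{k+2} - 2) - 2 + \delta_{0k},$$ where $\delta_{0k}$ is the Kronecker delta ($1$ if $k=0$, and $0$ otherwise). Furthermore, $$V(\mathfrak{G}(2^{k+1} - 1, m, 0)) \ge 2(2^{k+1} - 1)m - 2(2^{\lceil k/2\rceil} - 1) + V(\mathfrak{G}(2^{\lceil k/2 \rceil} - 1,\; 2^{\lfloor k/2 \rfloor + 1} - 1,\; 0)).$$ Alternatively, $$V(\mathfrak{G}(2^{k+1} - 1, m, 0)) \geq 2(2^{k+1} - 1)(m-1) + b(k),$$ where $b(k)$ is a number depending only on $k$ with $$3(2^{k+1} - 1) \leq b(k) \leq 4(2^{k+1} - 1) - 2.$$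
   Context: Candy Nim is played with the positions and moves of Nim: a position $[a_1,\dots,a_p]$ consists of $p$ piles with $a_i \ge 0$ candies, and in a move a player removes a positive number of candies from one pile. Players alternate; the player taking the last candy wins. A position is a $\mathcal{P}$ position if the bitwise XOR (nim-sum) $a_1\oplus\cdots\oplus a_p$ is $0$ (the player to move loses the underlying Nim game), and an $\mathcal{N}$ position otherwise. The losing player is called Luca and the winning player Windsor: in a $\mathcal{P}$ position it is Luca's turn, in an $\mathcal{N}$ position it is Windsor's turn. Luca may make any move; Windsor is forced to make winning Nim moves, i.e. each of his moves must lead to a $\mathcal{P}$ position. Subject to this, each player tries to collect as many candies as possible. For a position $G$, $N_L(G)$ and $N_W(G)$ are the numbers of candies collected by Luca and Windsor under optimal play (minimax), and the value of $G$ is $V(G) = N_L(G) - N_W(G)$. For integers $j\ge 0$, $m\ge 1$, write $\mathfrak{G}(2^{j}-1,m,0)=[2^{j}-1,\; 2^{j}m,\; 2^{j}(m+1)-1]$. For $j=0$ this is $[0,m,m]$.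
   Formalization: The lower bound 3(2^{k+1}-1) ≤ b(k) fails for k = 0,1,2,3 (m = 1 forces b(k) ≤ V([2^{k+1}-1, 2^{k+1}, 2^{k+2}-1])); it is replaced by 3(2^{k+1}-1)-1 for k = 0 and 3(2^{k+1}-1)-3 for k = 1,2,3, and is kept as stated for k ≥ 4. *)

theory Defs
  imports Complex_Main
begin

text \<open>A position is the list of its pile sizes.\<close>

type_synonym position = "nat list"

unbundle bit_operations_syntax

definition nim_sum :: "position \<Rightarrow> nat" where
  "nim_sum G = foldr (\<lambda>a s. a XOR s) G 0"

definition P_position :: "position \<Rightarrow> bool" where
  "P_position G \<longleftrightarrow> nim_sum G = 0"

text \<open>A move is recorded as a pair: the number \<open>c\<close> of candies collected by the player
  making the move, and the resulting position.\<close>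

definition moves :: "position \<Rightarrow> (nat \<times> position) set" where
  "moves G = {(c, G[i := G ! i - c]) | i c. i < length G \<and> 1 \<le> c \<and> c \<le> G ! i}"

definition winning_moves :: "position \<Rightarrow> (nat \<times> position) set" where
  "winning_moves G = {(c, H) \<in> moves G. P_position H}"

lemma sum_list_moves: "(c, H) \<in> moves G \<Longrightarrow> sum_list H < sum_list G"
proof -
  assume "(c, H) \<in> moves G"
  then obtain i where i: "i < length G" "1 \<le> c" "c \<le> G ! i" "H = G[i := G ! i - c]"
    by (auto simp: moves_def)
  have "G ! i \<le> sum_list G" using i(1) by (simp add: elem_le_sum_list)
  then show ?thesis using i by (simp add: sum_list_update)
qed

lemma sum_list_winning_moves: "(c, H) \<in> winning_moves G \<Longrightarrow> sum_list H < sum_list G"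
  by (auto simp: winning_moves_def sum_list_moves)

text \<open>Luca is to move exactly in the P positions and may make any move; Windsor is to move
  in the other positions and is restricted to winning moves (by Bouton's theorem
  \<open>winning_moves G\<close> is then nonempty, so every \<open>Min\<close> and \<open>Max\<close> below is taken over a
  finite nonempty set).  All candies are eventually collected by one of the two players, so
  the game has constant sum: maximising one's own total is the same as minimising the
  opponent's, and each of the two functions is the minimax value of the total of the
  respective player.\<close>

function N_L :: "position \<Rightarrow> nat" where
  "N_L G =
    (if P_position G
     then (if moves G = {} then 0 else Max ((\<lambda>(c, H). c + N_L H) ` moves G))
     else Min ((\<lambda>(c, H). N_L H) ` winning_moves G))"
  by pat_completeness auto
termination
  by (relation "measure sum_list") (auto simp: sum_list_moves sum_list_winning_moves)

function N_W :: "position \<Rightarrow> nat" where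
  "N_W G =
    (if P_position G
     then (if moves G = {} then 0 else Min ((\<lambda>(c, H). N_W H) ` moves G))
     else Max ((\<lambda>(c, H). c + N_W H) ` winning_moves G))"
  by pat_completeness auto
termination
  by (relation "measure sum_list") (auto simp: sum_list_moves sum_list_winning_moves)

declare N_L.simps [simp del] N_W.simps [simp del]

definition V :: "position \<Rightarrow> int" where
  "V G = int (N_L G) - int (N_W G)"

text \<open>\<open>\<GG> j m\<close> is the position written \<open>\<GG>(2\<^sup>j - 1, m, 0)\<close> in the paper.\<close>

definition \<GG> :: "nat \<Rightarrow> nat \<Rightarrow> position" where
  "\<GG> j m = [2 ^ j - 1, 2 ^ j * m, 2 ^ j * (m + 1) - 1]"

end

theory Submission
  imports Defs "HOL-Library.Multiset"
begin

text \<open>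
  The two players share all candies, so \<open>V G\<close> is the total number of candies minus
  \<open>2 * N_W G\<close> (lemma \<open>V_eq\<close>, which rests on Bouton's theorem
  \<open>winning_moves_nonempty\<close>).  Every estimate on \<open>V\<close> is therefore an estimate on the number of
  candies that Windsor collects; write \<open>w j m\<close> for \<open>N_W (\<GG> j m)\<close>.

  \<^emph>\<open>Upper bound on the value.\<close>  A three-pile P position satisfies the triangle inequalities,
  because the nim sum of two numbers is at most their sum.  Hence, however a round of one Luca
  move and one Windsor move is played, Luca gains at most \<open>2 a\<close> candies on Windsor, where \<open>a\<close>
  is any one fixed pile (\<open>round_le\<close>).  If \<open>a < 2 ^ j\<close>, then a round in which Windsor takes \<open>y\<close>
  candies removes at most \<open>2 ^ (j + 1) * y\<close> of them, so the whole play removes at most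
  \<open>2 ^ (j + 1)\<close> times what Windsor collects.  As \<open>\<GG> j m\<close> contains
  \<open>2 ^ (j + 1) * (m + 1) - 2\<close> candies, Windsor collects at least \<open>m + 1\<close> of them.

  \<^emph>\<open>Lower bounds on the value.\<close>  Luca plays moves to which Windsor has only one winning reply
  (\<open>N_W_forced_reply\<close>).  Reducing the largest pile of \<open>\<GG> j (m + 1)\<close> to \<open>2 ^ j * m\<close> forces
  Windsor to take a single candy and leaves a rearrangement of \<open>\<GG> j m\<close>; hence
  \<open>w j (m + 1) \<le> 1 + w j m\<close>.  In \<open>\<GG> j 1\<close>, reducing the largest pile to \<open>2 ^ c - 1\<close> forces
  Windsor to take \<open>2 ^ c\<close> candies and leaves a rearrangement of \<open>\<GG> c (2 ^ (j - c) - 1)\<close>.  With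
  \<open>j = k + 1\<close> and \<open>c = \<lceil>k / 2\<rceil>\<close> the two strategies together give the recursive bound.

  For the explicit bound let \<open>b k\<close> be the value of \<open>\<GG> (k + 1) 1\<close>.  Its upper estimate is
  \<open>w (k + 1) 1 \<ge> 2\<close>, the case \<open>m = 1\<close> of Windsor's lower bound.  For the lower estimate both strategies combine to
  \<open>w j 1 + 2 \<le> 2 ^ c + 2 ^ (j - c) + w c 1\<close>.  Starting from \<open>w 0 1 \<le> 1\<close> this yields the bounds
  2, 4, 6, 10 on \<open>w j 1\<close> for \<open>j = 1, 2, 3, 4\<close>, and for \<open>j \<ge> 5\<close> the choice \<open>c = 2\<close> gives
  \<open>w j 1 \<le> 2 ^ (j - 2) + 6\<close>, which is at most \<open>2 ^ (j - 1)\<close>.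
\<close>

section \<open>Nim sums\<close>

lemma xor_nat_eq_0_iff: "a XOR b = 0 \<longleftrightarrow> a = b" for a b :: nat
  by (metis xor_self_eq xor.assoc xor.right_neutral xor.left_neutral)

lemma xor_nat_le_add: "a XOR b \<le> a + b" for a b :: nat
proof (induction "a + b" arbitrary: a b rule: less_induct)
  case less
  show ?case
  proof (cases "a + b = 0")
    case True
    then show ?thesis by simp
  next
    case False
    then have "a div 2 + b div 2 < a + b" by linarith
    then have IH: "(a div 2) XOR (b div 2) \<le> a div 2 + b div 2" by (rule less)
    have "a XOR b = of_bool (odd a \<noteq> odd b) + 2 * ((a div 2) XOR (b div 2))"
      by (rule xor_rec)
    also have "\<dots> \<le> of_bool (odd a \<noteq> odd b) + 2 * (a div 2 + b div 2)"
      using IH by simp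
    also have "\<dots> \<le> a + b"
      by (cases "odd a"; cases "odd b") (auto elim!: oddE evenE)
    finally show ?thesis .
  qed
qed

lemma xor_add_low: "x < 2 ^ j \<Longrightarrow> (2 ^ j * n) XOR x = 2 ^ j * n + x" for x n :: nat
proof -
  assume "x < 2 ^ j"
  then have "x = take_bit j x" by (simp add: take_bit_nat_eq_self)
  then have "bit x i \<Longrightarrow> i < j" for i by (metis bit_take_bit_iff)
  then have "(2 ^ j * n) AND x = 0"
    by (intro bit_eqI) (use leD in \<open>auto simp: bit_simps simp flip: push_bit_eq_mult mult.commute[of n]\<close>)
  then show ?thesis by (simp add: disjunctive_add_eq_xor)
qed

text \<open>Counting set bits in the multiset of piles serves two purposes: it shows that the order of
  the piles is irrelevant, and it locates a pile with a given bit in the proof of Bouton's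
  theorem.\<close>

lemma bit_nim_sum: "bit (nim_sum G) h \<longleftrightarrow> odd (size (filter_mset (\<lambda>a. bit a h) (mset G)))"
  by (induction G) (auto simp: nim_sum_def bit_xor_iff)

lemma P_position_mset_cong: "mset G = mset H \<Longrightarrow> P_position G = P_position H"
proof -
  assume "mset G = mset H"
  then have "nim_sum G = nim_sum H" by (intro bit_eqI) (simp add: bit_nim_sum)
  then show ?thesis by (simp add: P_position_def)
qed

lemma nim_sum_update:
  "i < length G \<Longrightarrow> nim_sum (G[i := x]) = nim_sum G XOR (G ! i XOR x)"
proof (induction G arbitrary: i)
  case (Cons a G)
  have cancel: "x XOR s = (a XOR s) XOR (a XOR x)" for s
    by (metis xor.assoc xor.commute xor.right_neutral xor_self_eq)
  from Cons show ?case
    by (cases i) (use cancel in \<open>auto simp: nim_sum_def xor.assoc\<close>)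
qed simp

lemma P_position_three: "P_position [a, b, c] \<longleftrightarrow> c = a XOR b"
  using xor_nat_eq_0_iff[of "a XOR b" c] by (auto simp: P_position_def nim_sum_def xor.assoc)

section \<open>Moves\<close>

lemma finite_moves: "finite (moves G)"
proof -
  have "moves G \<subseteq> (\<lambda>(i, c). (c, G[i := G ! i - c])) ` ({..<length G} \<times> {..sum_list G})"
  proof
    fix z assume "z \<in> moves G"
    then obtain i c where ic: "i < length G" "c \<le> G ! i" and z: "z = (c, G[i := G ! i - c])"
      by (auto simp: moves_def)
    have "c \<le> sum_list G" using ic elem_le_sum_list[of i G] by linarith
    then have "(i, c) \<in> {..<length G} \<times> {..sum_list G}" using ic by simp
    then show "z \<in> (\<lambda>(i, c). (c, G[i := G ! i - c])) ` ({..<length G} \<times> {..sum_list G})"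
      unfolding z by (rule rev_image_eqI) simp
  qed
  then show ?thesis by (rule finite_subset) simp
qed

lemma finite_winning_moves: "finite (winning_moves G)"
  by (rule finite_subset[OF _ finite_moves]) (auto simp: winning_moves_def)

lemma sum_list_move: "(c, H) \<in> moves G \<Longrightarrow> sum_list G = c + sum_list H"
proof -
  assume "(c, H) \<in> moves G"
  then obtain i where i: "i < length G" "c \<le> G ! i" "H = G[i := G ! i - c]"
    by (auto simp: moves_def)
  then show ?thesis using elem_le_sum_list[of i G] by (simp add: sum_list_update)
qed

lemma not_P_position_move: "P_position G \<Longrightarrow> (c, H) \<in> moves G \<Longrightarrow> \<not> P_position H"
  by (auto simp: moves_def P_position_def nim_sum_update neq0_conv[symmetric] xor_nat_eq_0_iff
      simp del: neq0_conv)

text \<open>Bouton's theorem.  The leading bit \<open>h\<close> of the nim sum \<open>s \<noteq> 0\<close> is set in some pile \<open>a\<close>.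
  Passing from \<open>a\<close> to \<open>a XOR s\<close> clears bit \<open>h\<close> and leaves all higher bits alone, so it makes
  the pile smaller; and it makes the nim sum zero.\<close>

lemma winning_moves_nonempty:
  assumes "\<not> P_position G"
  shows "winning_moves G \<noteq> {}"
proof -
  define s where "s = nim_sum G"
  have "s \<ge> 1" using assms by (simp add: s_def P_position_def)
  then obtain h where h: "2 ^ h \<le> s" "s < 2 ^ (h + 1)" using ex_power_ivl1[of 2 s] by auto
  then have "s div 2 ^ h = 1" by (intro div_nat_eqI) auto
  then have drop_s: "drop_bit h s = 1" by (simp add: drop_bit_eq_div)
  then have "bit s h" by (simp add: bit_iff_odd_drop_bit)
  then have "filter_mset (\<lambda>a. bit a h) (mset G) \<noteq> {#}"
    unfolding s_def bit_nim_sum by (metis even_zero size_empty)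
  then obtain i where i: "i < length G" "bit (G ! i) h"
    by (auto simp: in_set_conv_nth)
  have "odd (drop_bit h (G ! i))" using i(2) by (simp add: bit_iff_odd_drop_bit)
  then have "drop_bit h (G ! i XOR s) < drop_bit h (G ! i)"
    using xor_one_eq[of "drop_bit h (G ! i)"] odd_pos[of "drop_bit h (G ! i)"]
    by (simp add: drop_s)
  then have "(G ! i XOR s) div 2 ^ h < G ! i div 2 ^ h" by (simp add: drop_bit_eq_div)
  then have less: "G ! i XOR s < G ! i" by (meson div_le_mono not_le)
  have "P_position (G[i := G ! i XOR s])"
    using i(1) unfolding P_position_def
    by (simp add: nim_sum_update s_def flip: xor.assoc)
  moreover have "(G ! i - (G ! i XOR s), G[i := G ! i XOR s]) \<in> moves G"
    using i(1) less unfolding moves_def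
    by (intro CollectI exI[of _ i] exI[of _ "G ! i - (G ! i XOR s)"]) auto
  ultimately show ?thesis by (auto simp: winning_moves_def)
qed

lemma moves_mset_cong:
  assumes "(c, H) \<in> moves G" "mset G = mset G'"
  shows "\<exists>H'. (c, H') \<in> moves G' \<and> mset H' = mset H"
proof -
  obtain i where i: "i < length G" "1 \<le> c" "c \<le> G ! i" "H = G[i := G ! i - c]"
    using assms(1) by (auto simp: moves_def)
  have "G ! i \<in> set G" using i(1) by simp
  then have "G ! i \<in> set G'" by (simp only: mset_eq_setD[OF assms(2)])
  then obtain i' where i': "i' < length G'" "G' ! i' = G ! i" by (auto simp: in_set_conv_nth)
  show ?thesis
  proof (intro exI conjI)
    show "(c, G'[i' := G' ! i' - c]) \<in> moves G'"
      unfolding moves_def using i(2,3) i' by (intro CollectI exI[of _ c] exI[of _ i']) simp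
    show "mset (G'[i' := G' ! i' - c]) = mset H"
      using i(1) i' by (simp add: i(4) mset_update assms(2))
  qed
qed

section \<open>The number of candies collected by Windsor\<close>

lemma N_W_Luca_le:
  assumes "P_position G" "(x, H) \<in> moves G"
  shows "N_W G \<le> N_W H"
proof -
  have "N_W G = Min ((\<lambda>(c, H). N_W H) ` moves G)" using assms by (subst N_W.simps) auto
  also have "\<dots> \<le> N_W H" using assms(2) finite_moves by (intro Min_le) force+
  finally show ?thesis .
qed

lemma N_W_Luca_attained:
  assumes "P_position G" "moves G \<noteq> {}"
  obtains x H where "(x, H) \<in> moves G" "N_W G = N_W H"
proof -
  have "N_W G = Min ((\<lambda>(c, H). N_W H) ` moves G)" using assms by (subst N_W.simps) auto
  also have "\<dots> \<in> (\<lambda>(c, H). N_W H) ` moves G" using assms(2) finite_moves by (intro Min_in) auto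
  finally show ?thesis using that by auto
qed

lemma N_W_Windsor_ge:
  assumes "\<not> P_position H" "(y, K) \<in> winning_moves H"
  shows "y + N_W K \<le> N_W H"
proof -
  have "y + N_W K \<le> Max ((\<lambda>(c, H). c + N_W H) ` winning_moves H)"
    using assms(2) finite_winning_moves by (intro Max_ge) force+
  also have "\<dots> = N_W H" using assms(1) by (subst (2) N_W.simps) simp
  finally show ?thesis .
qed

lemma N_W_Windsor_attained:
  assumes "\<not> P_position H"
  obtains y K where "(y, K) \<in> winning_moves H" "N_W H = y + N_W K"
proof -
  have "N_W H = Max ((\<lambda>(c, H). c + N_W H) ` winning_moves H)" using assms by (subst N_W.simps) simp
  also have "\<dots> \<in> (\<lambda>(c, H). c + N_W H) ` winning_moves H"
    using winning_moves_nonempty[OF assms] finite_winning_moves by (intro Max_in) auto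
  finally show ?thesis using that by auto
qed

text \<open>Windsor's forced replies produce the positions of interest only up to the order of their
  piles.  The options of two rearrangements correspond to each other, so their values agree by
  induction on the number of candies.\<close>

lemma N_W_mset_cong: "mset G = mset G' \<Longrightarrow> N_W G = N_W G'"
proof (induction "sum_list G" arbitrary: G G' rule: less_induct)
  case less
  have step: "\<exists>H'. (c, H') \<in> moves B \<and> N_W H' = N_W H \<and> (P_position H' \<longleftrightarrow> P_position H)"
    if AB: "mset A = mset G" "mset B = mset G" and that: "(c, H) \<in> moves A" for A B c H
  proof -
    have "\<exists>H'. (c, H') \<in> moves B \<and> mset H' = mset H"
      using AB by (intro moves_mset_cong[OF that]) simp
    then obtain H' where H': "(c, H') \<in> moves B" "mset H' = mset H" by blast
    have "sum_list H < sum_list G"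
      using sum_list_moves[OF that] AB(1) by (simp flip: sum_mset_sum_list)
    then have "N_W H = N_W H'" using H'(2) by (intro less(1)) simp_all
    then show ?thesis using H' P_position_mset_cong[OF H'(2)] by auto
  qed
  have moves_sub: "N_W ` snd ` moves A \<subseteq> N_W ` snd ` moves B"
    if AB: "mset A = mset G" "mset B = mset G" for A B
  proof clarify
    fix c H assume "(c, H) \<in> moves A"
    then obtain H' where "(c, H') \<in> moves B" "N_W H' = N_W H" using step[OF AB] by blast
    then show "N_W (snd (c, H)) \<in> N_W ` snd ` moves B" by (metis imageI snd_conv)
  qed
  have winning_sub:
    "(\<lambda>(c, H). c + N_W H) ` winning_moves A \<subseteq> (\<lambda>(c, H). c + N_W H) ` winning_moves B"
    if AB: "mset A = mset G" "mset B = mset G" for A B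
  proof clarify
    fix c H assume "(c, H) \<in> winning_moves A"
    then have "(c, H) \<in> moves A" "P_position H" by (simp_all add: winning_moves_def)
    then obtain H' where "(c, H') \<in> winning_moves B" "N_W H' = N_W H"
      using step[OF AB] by (auto simp: winning_moves_def)
    then show "c + N_W H \<in> (\<lambda>(c, H). c + N_W H) ` winning_moves B"
      by (intro rev_image_eqI) auto
  qed
  have eq: "N_W ` snd ` moves G = N_W ` snd ` moves G'"
    "(\<lambda>(c, H). c + N_W H) ` winning_moves G = (\<lambda>(c, H). c + N_W H) ` winning_moves G'"
    by (intro equalityI moves_sub winning_sub; simp add: less(2))+
  have "(\<lambda>(c, H). N_W H) ` moves A = N_W ` snd ` moves A" for A
    by (auto simp: image_image case_prod_beta)
  moreover have "moves G = {} \<longleftrightarrow> moves G' = {}" using eq(1) by auto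
  ultimately show ?case
    using eq P_position_mset_cong[OF less(2)]
    unfolding N_W.simps[of G] N_W.simps[of G'] by simp
qed

text \<open>The game has constant sum: by induction a maximum over \<open>N_L\<close> of the options is the same
  as a minimum over \<open>N_W\<close>.  In an N position this needs a winning move to exist, since otherwise
  \<open>Min\<close> and \<open>Max\<close> would be taken over the empty set.\<close>

lemma N_L_add_N_W: "N_L G + N_W G = sum_list G"
proof (induction "sum_list G" arbitrary: G rule: less_induct)
  case less
  show ?case
  proof (cases "P_position G")
    case P: True
    show ?thesis
    proof (cases "moves G = {}")
      case True
      have "sum_list G = 0"
      proof (rule ccontr)
        assume "sum_list G \<noteq> 0"
        then obtain i where "i < length G" "G ! i \<noteq> 0"
          by (auto simp: in_set_conv_nth)
        then have "(1, G[i := G ! i - 1]) \<in> moves G" by (force simp: moves_def)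
        with True show False by simp
      qed
      with True P show ?thesis by (simp add: N_L.simps N_W.simps)
    next
      case False
      obtain x H where H: "(x, H) \<in> moves G" "N_W G = N_W H"
        using N_W_Luca_attained[OF P False] .
      have "N_L G = Max ((\<lambda>(c, H). c + N_L H) ` moves G)"
        using P False by (subst N_L.simps) simp
      also have "\<dots> = sum_list G - N_W G"
      proof (rule Max_eqI)
        show "finite ((\<lambda>(c, H). c + N_L H) ` moves G)" using finite_moves by simp
        show "sum_list G - N_W G \<in> (\<lambda>(c, H). c + N_L H) ` moves G"
          using H less[OF sum_list_moves[OF H(1)]] sum_list_move[OF H(1)]
          by (intro rev_image_eqI[OF H(1)]) simp
        fix z assume "z \<in> (\<lambda>(c, H). c + N_L H) ` moves G"
        then obtain c K where K: "(c, K) \<in> moves G" "z = c + N_L K" by auto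
        then show "z \<le> sum_list G - N_W G"
          using less[OF sum_list_moves[OF K(1)]] sum_list_move[OF K(1)] N_W_Luca_le[OF P K(1)] by simp
      qed
      finally show ?thesis
        using H less[OF sum_list_moves[OF H(1)]] sum_list_move[OF H(1)] by simp
    qed
  next
    case N: False
    obtain y K where K: "(y, K) \<in> winning_moves G" "N_W G = y + N_W K"
      using N_W_Windsor_attained[OF N] .
    have win: "sum_list G = c + sum_list H \<and> N_L H + N_W H = sum_list H"
      if "(c, H) \<in> winning_moves G" for c H
      using that less[of H] sum_list_move[of c H G] sum_list_winning_moves[OF that]
      by (simp add: winning_moves_def)
    have "N_L G = Min ((\<lambda>(c, H). N_L H) ` winning_moves G)"
      using N by (subst N_L.simps) simp
    also have "\<dots> = sum_list G - N_W G"
    proof (rule Min_eqI)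
      show "finite ((\<lambda>(c, H). N_L H) ` winning_moves G)" using finite_winning_moves by simp
      show "sum_list G - N_W G \<in> (\<lambda>(c, H). N_L H) ` winning_moves G"
        using K(2) win[OF K(1)] by (intro rev_image_eqI[OF K(1)]) auto
      fix z assume "z \<in> (\<lambda>(c, H). N_L H) ` winning_moves G"
      then obtain c H where H: "(c, H) \<in> winning_moves G" "z = N_L H" by auto
      then show "sum_list G - N_W G \<le> z"
        using win[OF H(1)] N_W_Windsor_ge[OF N H(1)] by linarith
    qed
    finally show ?thesis using K(2) win[OF K(1)] by simp
  qed
qed

lemma V_eq: "V G = int (sum_list G) - 2 * int (N_W G)"
  using N_L_add_N_W[of G] by (simp add: V_def)

lemma moves_three:
  "(x, H) \<in> moves [p, q, r] \<longleftrightarrow> 1 \<le> x \<and>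
     (x \<le> p \<and> H = [p - x, q, r] \<or> x \<le> q \<and> H = [p, q - x, r] \<or> x \<le> r \<and> H = [p, q, r - x])"
proof -
  have "(x, H) \<in> moves [p, q, r] \<longleftrightarrow>
      (\<exists>i\<in>{..<3}. 1 \<le> x \<and> x \<le> [p, q, r] ! i \<and> H = [p, q, r][i := [p, q, r] ! i - x])"
    by (auto simp: moves_def)
  also have "{..<3} = {0, 1, 2 :: nat}" by auto
  finally show ?thesis by auto
qed

section \<open>A lower bound for Windsor\<close>

text \<open>In every P position \<open>[p, q, r]\<close> the piles \<open>q\<close> and \<open>r\<close> differ by at most \<open>p\<close>.  Before the
  round the difference is at most \<open>a\<close>, after it at most \<open>a' \<le> a\<close>; so if the players move in the
  last two piles, their takings differ by at most \<open>2 * a\<close>.  If Luca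
  moves in the first pile, then \<open>x \<le> a\<close>; if Windsor does, then only one of the last two piles
  changes, and it moves from within \<open>a\<close> to within \<open>a'\<close> of the other, so \<open>x \<le> a + a'\<close>.  The
  second conclusion keeps the estimate available in the following rounds.\<close>

lemma round_le:
  assumes "P_position [a, b, c]" "(x, H) \<in> moves [a, b, c]" "(y, K) \<in> winning_moves H"
  shows "x \<le> y + 2 * a"
    and "\<exists>a' b' c'. K = [a', b', c'] \<and> a' \<le> a"
proof -
  have triangle: "q \<le> p + r \<and> r \<le> p + q" if "P_position [p, q, r]" for p q r
  proof -
    have r: "r = p XOR q" using that by (simp add: P_position_three)
    then have "q = p XOR r" by (simp flip: xor.assoc)
    then show ?thesis using r xor_nat_le_add by metis
  qed
  have K: "P_position K" "(y, K) \<in> moves H" using assms(3) by (auto simp: winning_moves_def)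
  show "\<exists>a' b' c'. K = [a', b', c'] \<and> a' \<le> a"
    using assms(2) K(2) by (auto simp: moves_three)
  show "x \<le> y + 2 * a"
    using assms(2) K triangle[OF assms(1)] by (auto simp: moves_three dest!: triangle)
qed

text \<open>With \<open>y \<ge> 1\<close> and \<open>a \<le> 2 ^ j - 1\<close>, a round removes
  \<open>x + y \<le> 2 * y + 2 * a \<le> 2 ^ (j + 1) * y\<close> candies; the claim adds this up over all rounds.\<close>

lemma sum_list_le_N_W:
  assumes "P_position [a, b, c]" "a < 2 ^ j"
  shows "a + b + c \<le> 2 ^ (j + 1) * N_W [a, b, c]"
  using assms
proof (induction "a + b + c" arbitrary: a b c rule: less_induct)
  case less
  show ?case
  proof (cases "moves [a, b, c] = {}")
    case True
    then have "sum_list [a, b, c] = 0"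
      using N_L_add_N_W[of "[a, b, c]"] less(2) by (simp add: N_L.simps N_W.simps)
    then show ?thesis by simp
  next
    case False
    obtain x H where H: "(x, H) \<in> moves [a, b, c]" "N_W [a, b, c] = N_W H"
      using N_W_Luca_attained[OF less(2) False] .
    obtain y K where K: "(y, K) \<in> winning_moves H" "N_W H = y + N_W K"
      using N_W_Windsor_attained not_P_position_move[OF less(2) H(1)] .
    obtain a' b' c' where K': "K = [a', b', c']" "a' \<le> a"
      using round_le(2)[OF less(2) H(1) K(1)] by auto
    have sum: "a + b + c = x + y + (a' + b' + c')"
      using sum_list_move[OF H(1)] sum_list_move[of y K H] K(1) K'(1)
      by (simp add: winning_moves_def)
    have y: "1 \<le> y" using K(1) by (auto simp: winning_moves_def moves_def)
    have "a' + b' + c' \<le> 2 ^ (j + 1) * N_W K"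
      unfolding K'(1) using K(1) K' less(3) y sum
      by (intro less(1)) (auto simp: winning_moves_def)
    moreover have "x + y \<le> 2 ^ (j + 1) * y"
    proof -
      have "x + y \<le> 2 * y + 2 * a" using round_le(1)[OF less(2) H(1) K(1)] by simp
      also have "\<dots> \<le> 2 * y + 2 * (2 ^ j - 1)" using less(3) by simp
      also have "\<dots> \<le> 2 * y + 2 * ((2 ^ j - 1) * y)" using y by simp
      also have "\<dots> = 2 ^ (j + 1) * y" by (simp add: algebra_simps)
      finally show ?thesis .
    qed
    ultimately show ?thesis using sum H(2) K(2) by (simp add: algebra_simps)
  qed
qed

lemma P_position_GG: "P_position (\<GG> j m)"
  using xor_add_low[of "2 ^ j - 1" j m]
  by (simp add: \<GG>_def P_position_three xor.commute algebra_simps)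

lemma sum_list_GG: "int (sum_list (\<GG> j m)) = 2 ^ (j + 1) * (int m + 1) - 2"
proof -
  have "(1::nat) \<le> 2 ^ j" "(1::nat) \<le> 2 ^ j * (m + 1)" by (simp_all add: Suc_le_eq)
  then show ?thesis unfolding \<GG>_def by (simp add: of_nat_diff algebra_simps)
qed

text \<open>The total \<open>2 ^ (j + 1) * (m + 1) - 2\<close> exceeds \<open>2 ^ (j + 1) * m\<close> because \<open>j \<ge> 1\<close>, so
  Windsor collects strictly more than \<open>m\<close>.\<close>

lemma N_W_GG_ge:
  assumes "j \<ge> 1"
  shows "m + 1 \<le> N_W (\<GG> j m)"
proof -
  have "int (sum_list (\<GG> j m)) \<le> int (2 ^ (j + 1) * N_W (\<GG> j m))"
    using sum_list_le_N_W[of "2 ^ j - 1" "2 ^ j * m" "2 ^ j * (m + 1) - 1" j] P_position_GG[of j m]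
    unfolding \<GG>_def of_nat_le_iff by simp
  then have "2 ^ (j + 1) * (int m + 1) - 2 \<le> 2 ^ (j + 1) * int (N_W (\<GG> j m))"
    by (simp only: sum_list_GG) simp
  moreover have "(2::int) < 2 ^ (j + 1)" using assms by (simp add: one_less_power)
  ultimately have "(2::int) ^ (j + 1) * int m < 2 ^ (j + 1) * int (N_W (\<GG> j m))"
    by (simp only: distrib_left mult_1_right)
  then show ?thesis by (simp add: mult_less_cancel_left)
qed

section \<open>A strategy for Luca\<close>

text \<open>Luca reduces the third pile from \<open>s\<close> to \<open>r\<close>.  A winning reply must change some pile to the
  nim sum of the other two.  For the first pile that value is \<open>q XOR r \<ge> p\<close>, for the third it is
  \<open>s > r\<close>; neither is a reduction, so Windsor has to reduce the second pile to \<open>p XOR r\<close>.\<close>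

lemma N_W_forced_reply:
  assumes s: "s = p XOR q" and "r < s" and p: "p \<le> q XOR r"
  shows "N_W [p, q, s] \<le> (q - (p XOR r)) + N_W [p, p XOR r, r]"
proof -
  have P: "P_position [p, q, s]" using s by (simp add: P_position_three)
  have move: "(s - r, [p, q, r]) \<in> moves [p, q, s]"
    using \<open>r < s\<close> unfolding moves_def by (intro CollectI exI[of _ 2] exI[of _ "s - r"]) auto
  obtain y K where K: "(y, K) \<in> winning_moves [p, q, r]" "N_W [p, q, r] = y + N_W K"
    using N_W_Windsor_attained not_P_position_move[OF P move] .
  have y: "1 \<le> y" and PK: "P_position K"
    and "y \<le> p \<and> K = [p - y, q, r] \<or> y \<le> q \<and> K = [p, q - y, r] \<or> y \<le> r \<and> K = [p, q, r - y]"
    using K(1) by (simp_all add: winning_moves_def moves_three)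
  then consider "y \<le> p" "K = [p - y, q, r]" | "y \<le> q" "K = [p, q - y, r]" | "K = [p, q, r - y]"
    by blast
  then have "K = [p, p XOR r, r] \<and> y = q - (p XOR r)"
  proof cases
    case 1
    then have "p - y = q XOR r" using PK by (auto simp: P_position_three xor.commute[of q] xor.assoc)
    then show ?thesis using p y 1 by simp
  next
    case 2
    then have "q - y = p XOR r" using PK by (auto simp: P_position_three simp flip: xor.assoc)
    then show ?thesis using 2 by simp
  next
    case 3
    then have "r - y = s" using PK s by (simp add: P_position_three)
    then show ?thesis using \<open>r < s\<close> by simp
  qed
  then show ?thesis using N_W_Luca_le[OF P move] K(2) by simp
qed

text \<open>Luca takes \<open>2 ^ (j + 1) - 1\<close> candies from the largest pile; Windsor has to take a single
  candy from the middle one.\<close>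

lemma N_W_GG_Suc: "N_W (\<GG> j (Suc m)) \<le> 1 + N_W (\<GG> j m)"
proof -
  let ?p = "2 ^ j - 1 :: nat"
  have low: "?p XOR (2 ^ j * m) = 2 ^ j * (m + 1) - 1"
    using xor_add_low[of ?p j m] by (simp add: xor.commute algebra_simps)
  have s: "2 ^ j * (Suc m + 1) - 1 = ?p XOR (2 ^ j * Suc m)"
    using xor_add_low[of ?p j "Suc m"] by (simp add: xor.commute algebra_simps)
  \<comment> \<open>The nim sum of two different multiples of \<open>2 ^ j\<close> is a nonzero multiple of \<open>2 ^ j\<close>, so
    Windsor cannot answer in the first pile.\<close>
  have "(2 ^ j * Suc m) XOR (2 ^ j * m) = 2 ^ j * (Suc m XOR m)"
    using push_bit_xor[of j "Suc m" m] by (simp add: push_bit_eq_mult mult.commute)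
  moreover have "Suc m XOR m \<noteq> 0" by (simp add: xor_nat_eq_0_iff)
  moreover have pow_gt: "(1::nat) < 2 ^ j + 2 ^ j" using one_le_power[of "2::nat" j] by linarith
  ultimately have "?p \<le> (2 ^ j * Suc m) XOR (2 ^ j * m)"
    by (metis One_nat_def diff_le_self le_trans less_eq_Suc_le mult.right_neutral mult_le_mono2 neq0_conv)
  then have "N_W (\<GG> j (Suc m)) \<le> (2 ^ j * Suc m - (?p XOR (2 ^ j * m))) + N_W [?p, ?p XOR (2 ^ j * m), 2 ^ j * m]"
    unfolding \<GG>_def using pow_gt
    by (intro N_W_forced_reply s) (simp_all add: less_diff_conv)
  moreover have "N_W [?p, ?p XOR (2 ^ j * m), 2 ^ j * m] = N_W (\<GG> j m)"
    unfolding \<GG>_def low by (rule N_W_mset_cong) simp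
  moreover have "2 ^ j * Suc m - (?p XOR (2 ^ j * m)) = 1"
    unfolding low using pow_gt by simp
  ultimately show ?thesis by simp
qed

lemma N_W_GG_add: "N_W (\<GG> j (m + n)) \<le> n + N_W (\<GG> j m)"
proof (induction n)
  case (Suc n)
  then show ?case using N_W_GG_Suc[of j "m + n"] by simp
qed simp

text \<open>Luca reduces the largest pile to \<open>2 ^ c - 1\<close>, and Windsor has to reduce the pile
  \<open>2 ^ j\<close> to \<open>(2 ^ j - 1) XOR (2 ^ c - 1) = 2 ^ j - 2 ^ c = 2 ^ c * (2 ^ (j - c) - 1)\<close>.  The pile
  \<open>2 ^ j - 1\<close> stays and plays the part of the last pile of \<open>\<GG> c (2 ^ (j - c) - 1)\<close>.\<close>

lemma N_W_GG_one:
  assumes "c \<le> j"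
  shows "N_W (\<GG> j 1) \<le> 2 ^ c + N_W (\<GG> c (2 ^ (j - c) - 1))"
proof -
  let ?p = "2 ^ j - 1 :: nat" and ?r = "2 ^ c - 1 :: nat" and ?t = "2 ^ c * (2 ^ (j - c) - 1) :: nat"
  have pow: "(2::nat) ^ c * 2 ^ (j - c) = 2 ^ j" using assms by (simp flip: power_add)
  have le: "(2::nat) ^ c \<le> 2 ^ j" using assms by simp
  have less: "(2::nat) ^ c < 2 ^ j + 2 ^ j" using le one_le_power[of "2::nat" j] by linarith
  have t: "?t = 2 ^ j - 2 ^ c" using pow by (simp add: diff_mult_distrib2)
  have "?t XOR ?r = ?p" using xor_add_low[of ?r c "2 ^ (j - c) - 1"] le unfolding t by simp
  then have xor_t: "?p XOR ?r = ?t" by (metis xor.assoc xor.right_neutral xor_self_eq)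
  have s: "2 ^ j * (1 + 1) - 1 = ?p XOR (2 ^ j * 1)"
    using xor_add_low[of ?p j 1] by (simp add: xor.commute)
  have "(2 ^ j * 1) XOR ?r = 2 ^ j * 1 + ?r"
    by (intro xor_add_low less_le_trans[OF _ le]) simp
  then have "N_W (\<GG> j 1) \<le> (2 ^ j * 1 - (?p XOR ?r)) + N_W [?p, ?p XOR ?r, ?r]"
    using le less unfolding \<GG>_def by (intro N_W_forced_reply s) (simp_all add: less_diff_conv)
  moreover have "2 ^ j * 1 - (?p XOR ?r) = 2 ^ c" unfolding xor_t t using le by simp
  moreover have "N_W [?p, ?p XOR ?r, ?r] = N_W (\<GG> c (2 ^ (j - c) - 1))"
    unfolding xor_t \<GG>_def using pow by (intro N_W_mset_cong) simp
  ultimately show ?thesis by simp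
qed

lemma N_W_GG_one_split:
  assumes "c < j"
  shows "N_W (\<GG> j 1) + 2 \<le> 2 ^ c + 2 ^ (j - c) + N_W (\<GG> c 1)"
proof -
  have "(2::nat) ^ 1 \<le> 2 ^ (j - c)" using assms by (intro power_increasing) auto
  then obtain n where n: "(2::nat) ^ (j - c) = 2 + n" by (auto simp: le_iff_add)
  show ?thesis
    using N_W_GG_one[of c j] N_W_GG_add[of c 1 n] assms by (simp add: n)
qed

text \<open>Equivalent to the lower estimate on \<open>b k = V (\<GG> (k + 1) 1)\<close>.  The small cases use
  \<open>c = 0, 1, 1, 2\<close> for \<open>j = k + 1 = 1, 2, 3, 4\<close>, and all larger ones \<open>c = 2\<close>.\<close>

lemma N_W_GG_one_le:
  "2 * N_W (\<GG> (k + 1) 1) \<le> 2 ^ (k + 1) + 1 + (if k = 0 then 1 else if k < 4 then 3 else 0)"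
proof -
  have "N_W (\<GG> 0 0) = 0" using N_L_add_N_W[of "\<GG> 0 0"] by (simp add: \<GG>_def)
  then have "N_W (\<GG> 0 1) \<le> 1" using N_W_GG_Suc[of 0 0] by simp
  then have 1: "N_W (\<GG> 1 1) \<le> 2" using N_W_GG_one_split[of 0 1] by simp
  then have 2: "N_W (\<GG> 2 1) \<le> 4" using N_W_GG_one_split[of 1 2] by simp
  have 3: "N_W (\<GG> 3 1) \<le> 6" using N_W_GG_one_split[of 1 3] 1 by simp
  have 4: "N_W (\<GG> 4 1) \<le> 10" using N_W_GG_one_split[of 2 4] 2 by simp
  show ?thesis
  proof (cases "k < 4")
    case True
    then consider "k = 0" | "k = 1" | "k = 2" | "k = 3" by linarith
    then show ?thesis using 1 2 3 4 by cases (simp_all add: numeral_eq_Suc)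
  next
    case False
    then obtain n where k: "k = n + 4" by (metis add.commute le_Suc_ex not_le)
    have "N_W (\<GG> (k + 1) 1) \<le> 8 * 2 ^ n + 6"
      using N_W_GG_one_split[of 2 "k + 1"] 2 unfolding k by (simp add: power_add)
    moreover have "(2::nat) ^ (k + 1) = 32 * 2 ^ n" by (simp add: k power_add)
    ultimately have "2 * N_W (\<GG> (k + 1) 1) \<le> 2 ^ (k + 1) + 1"
      using one_le_power[of "2::nat" n] by linarith
    then show ?thesis using False by simp
  qed
qed

lemma V_GG: "V (\<GG> j m) = 2 ^ (j + 1) * (int m + 1) - 2 - 2 * int (N_W (\<GG> j m))"
  by (simp only: V_eq sum_list_GG)

theorem theorem5p1:
  shows "(\<forall>k m :: nat. m \<ge> 1 \<longrightarrow>
            V (\<GG> (k + 1) m)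
              \<le> (2 ^ (k + 2) - 2) * int m + (2 ^ (k + 2) - 2) - 2 + (if k = 0 then 1 else 0))
       \<and> (\<forall>k m :: nat. m \<ge> 1 \<longrightarrow>
            V (\<GG> (k + 1) m)
              \<ge> 2 * (2 ^ (k + 1) - 1) * int m - 2 * (2 ^ nat \<lceil>real k / 2\<rceil> - 1)
                + V (\<GG> (nat \<lceil>real k / 2\<rceil>) (2 ^ (nat \<lfloor>real k / 2\<rfloor> + 1) - 1)))
       \<and> (\<exists>b :: nat \<Rightarrow> int. \<forall>k :: nat.
            3 * (2 ^ (k + 1) - 1) - (if k = 0 then 1 else if k < 4 then 3 else 0) \<le> b k
          \<and> b k \<le> 4 * (2 ^ (k + 1) - 1) - 2
          \<and> (\<forall>m :: nat. m \<ge> 1 \<longrightarrow>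
               V (\<GG> (k + 1) m) \<ge> 2 * (2 ^ (k + 1) - 1) * (int m - 1) + b k))"
proof (intro conjI allI impI exI[of _ "\<lambda>k. V (\<GG> (k + 1) 1)"])
  fix k m :: nat
  have "int m + 1 \<le> int (N_W (\<GG> (k + 1) m))" using N_W_GG_ge[of "k + 1" m] by linarith
  then show "V (\<GG> (k + 1) m)
      \<le> (2 ^ (k + 2) - 2) * int m + (2 ^ (k + 2) - 2) - 2 + (if k = 0 then 1 else 0)"
    by (auto simp: V_GG algebra_simps)
next
  fix k m :: nat
  assume "m \<ge> 1"
  define c f where "c = nat \<lceil>real k / 2\<rceil>" and "f = nat \<lfloor>real k / 2\<rfloor>"
  have k: "k = c + f"
  proof (cases "even k")
    case True
    then show ?thesis by (auto simp: c_def f_def elim!: evenE)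
  next
    case False
    then obtain n where "k = 2 * n + 1" by (auto elim: oddE)
    then have "\<lceil>real k / 2\<rceil> = int n + 1" "\<lfloor>real k / 2\<rfloor> = int n"
      by (auto simp: ceiling_eq_iff floor_eq_iff)
    then show ?thesis using \<open>k = 2 * n + 1\<close> by (simp add: c_def f_def)
  qed
  have "N_W (\<GG> (k + 1) m) + 1 \<le> m + 2 ^ c + N_W (\<GG> c (2 ^ (f + 1) - 1))"
    using N_W_GG_add[of "k + 1" 1 "m - 1"] N_W_GG_one[of c "k + 1"] \<open>m \<ge> 1\<close> k
    by (simp add: Suc_diff_le)
  then have "int (N_W (\<GG> (k + 1) m) + 1) \<le> int (m + 2 ^ c + N_W (\<GG> c (2 ^ (f + 1) - 1)))"
    by (simp only: of_nat_le_iff)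
  moreover have "int (2 ^ (f + 1) - 1) + 1 = 2 ^ (f + 1)" by (simp add: of_nat_diff)
  ultimately show "V (\<GG> (k + 1) m)
      \<ge> 2 * (2 ^ (k + 1) - 1) * int m - 2 * (2 ^ c - 1) + V (\<GG> c (2 ^ (f + 1) - 1))"
    unfolding V_GG k by (simp add: algebra_simps power_add)
next
  fix k :: nat
  have "int (2 * N_W (\<GG> (k + 1) 1))
      \<le> int (2 ^ (k + 1) + 1 + (if k = 0 then 1 else if k < 4 then 3 else 0))"
    using N_W_GG_one_le of_nat_le_iff by blast
  then show "3 * (2 ^ (k + 1) - 1) - (if k = 0 then 1 else if k < 4 then 3 else 0)
      \<le> V (\<GG> (k + 1) 1)"
    by (simp add: V_GG split: if_splits)
next
  fix k :: nat
  show "V (\<GG> (k + 1) 1) \<le> 4 * (2 ^ (k + 1) - 1) - 2"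
    using N_W_GG_ge[of "k + 1" 1] by (simp add: V_GG)
next
  fix k m :: nat
  assume "m \<ge> 1"
  then have "int (N_W (\<GG> (k + 1) m)) \<le> int m - 1 + int (N_W (\<GG> (k + 1) 1))"
    using N_W_GG_add[of "k + 1" 1 "m - 1"] by simp
  then show "V (\<GG> (k + 1) m) \<ge> 2 * (2 ^ (k + 1) - 1) * (int m - 1) + V (\<GG> (k + 1) 1)"
    by (simp add: V_GG algebra_simps)
qed

end
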